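(* Let $\Gamma$ be an uncountable index set. Then the Banach space $l^1(\Gamma)$, with the metric induced by its norm, has the Lebesgue property; that is, every Riemann integrable function $f:[a,b]\to l^1(\Gamma)$ is continuous almost everywhere on $[a,b]$.
   Context: $l^1(\Gamma)$ is the space of real families $x=(x_\alpha)_{\alpha\in\Gamma}$ such that $\{\alpha\in\Gamma:x_\alpha\neq0\}$ is countable and $\sum_{\alpha\in\Gamma}|x_\alpha|<+\infty$, with norm $\|x\|:=\sum_{\alpha\in\Gamma}|x_\alpha|$. Let $X$ be a real vector space with a complete and invariant metric ${\bf d}$ (invariant: ${\bf d}(x+z,y+z)={\bf d}(x,y)$), here ${\bf d}(x,y)=\|x-y\|$. A tagged partition of $[a,b]$ is $\Delta=\{(s_i,[t_{i-1},t_i]):1\le i\le N\}$ with $a=t_0<t_1<\dots<t_N=b$ and $s_i\in[t_{i-1},t_i]$; write $|\Delta|:=\max_{1\le i\le N}(t_i-t_{i-1})$ and $f(\Delta):=\sum_{i=1}^N(t_i-t_{i-1})f(s_i)$. A function $f:[a,b]\to X$ is Riemann integrable on $[a,b]$ if there is $\bar x\in X$ such that for every $\varepsilon>0$ there is $\delta>0$ with ${\bf d}(f(\Delta),\bar x)<\varepsilon$ for every tagged partition $\Delta$ of $[a,b]$ with $|\Delta|<\delta$. $X$ has the Lebesgue property if every Riemann integrable function $f:[a,b]\to X$ is continuous at Lebesgue-almost every point of $[a,b]$. *)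

theory Defs
  imports "HOL-Analysis.Analysis"
begin

section \<open>The Banach space $l^1(\Gamma)$\<close>

text \<open>The index set $\Gamma$ is the universe of the type variable \<open>'i\<close>.\<close>

typedef 'i ell1 =
  "{x :: 'i \<Rightarrow> real. countable {\<alpha>. x \<alpha> \<noteq> 0} \<and> (\<lambda>\<alpha>. \<bar>x \<alpha>\<bar>) summable_on UNIV}"
  morphisms coord Abs_ell1
  by (rule exI[of _ "\<lambda>_. 0"]) simp

setup_lifting type_definition_ell1

lemma abs_summable_imp_countable_support:
  fixes x :: "'i \<Rightarrow> real"
  assumes "(\<lambda>\<alpha>. \<bar>x \<alpha>\<bar>) summable_on UNIV"
  shows "countable {\<alpha>. x \<alpha> \<noteq> 0}"
  using summable_countable_real[OF assms] by simp

lemma abs_summable_lincomb: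
  fixes x y :: "'i \<Rightarrow> real"
  assumes "(\<lambda>\<alpha>. \<bar>x \<alpha>\<bar>) summable_on UNIV" "(\<lambda>\<alpha>. \<bar>y \<alpha>\<bar>) summable_on UNIV"
  shows "(\<lambda>\<alpha>. \<bar>r * x \<alpha> + s * y \<alpha>\<bar>) summable_on UNIV"
proof (rule summable_on_comparison_test)
  show "(\<lambda>\<alpha>. \<bar>r\<bar> * \<bar>x \<alpha>\<bar> + \<bar>s\<bar> * \<bar>y \<alpha>\<bar>) summable_on UNIV"
    by (intro summable_on_add summable_on_cmult_right assms)
  show "\<bar>r * x \<alpha> + s * y \<alpha>\<bar> \<le> \<bar>r\<bar> * \<bar>x \<alpha>\<bar> + \<bar>s\<bar> * \<bar>y \<alpha>\<bar>" for \<alpha>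
    by (metis abs_mult abs_triangle_ineq)
qed simp

lemma summable_coord: "(\<lambda>\<alpha>. \<bar>coord x \<alpha>\<bar>) summable_on UNIV"
  using coord[of x] by simp

instantiation ell1 :: (type) real_vector
begin

lift_definition zero_ell1 :: "'a ell1" is "\<lambda>_. 0"
  by simp

lift_definition plus_ell1 :: "'a ell1 \<Rightarrow> 'a ell1 \<Rightarrow> 'a ell1" is "\<lambda>x y \<alpha>. x \<alpha> + y \<alpha>"
  using abs_summable_lincomb[of _ _ 1 1] abs_summable_imp_countable_support by fastforce

lift_definition minus_ell1 :: "'a ell1 \<Rightarrow> 'a ell1 \<Rightarrow> 'a ell1" is "\<lambda>x y \<alpha>. x \<alpha> - y \<alpha>"
  using abs_summable_lincomb[of _ _ 1 "-1"] abs_summable_imp_countable_support by fastforce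

lift_definition uminus_ell1 :: "'a ell1 \<Rightarrow> 'a ell1" is "\<lambda>x \<alpha>. - x \<alpha>"
  by simp

lift_definition scaleR_ell1 :: "real \<Rightarrow> 'a ell1 \<Rightarrow> 'a ell1" is "\<lambda>r x \<alpha>. r * x \<alpha>"
  using abs_summable_lincomb[of _ "\<lambda>_. 0" _ 0] abs_summable_imp_countable_support by fastforce

instance
  by standard (transfer; simp add: algebra_simps)+

end

instantiation ell1 :: (type) real_normed_vector
begin

lift_definition norm_ell1 :: "'a ell1 \<Rightarrow> real" is "\<lambda>x. \<Sum>\<^sub>\<infinity>\<alpha>. \<bar>x \<alpha>\<bar>" .

definition dist_ell1 :: "'a ell1 \<Rightarrow> 'a ell1 \<Rightarrow> real"
  where "dist_ell1 x y = norm (x - y)"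

definition sgn_ell1 :: "'a ell1 \<Rightarrow> 'a ell1"
  where "sgn_ell1 x = x /\<^sub>R norm x"

definition uniformity_ell1 :: "('a ell1 \<times> 'a ell1) filter"
  where "uniformity_ell1 = (INF e\<in>{0<..}. principal {(x, y). dist x y < e})"

definition open_ell1 :: "'a ell1 set \<Rightarrow> bool"
  where "open_ell1 U \<longleftrightarrow> (\<forall>x\<in>U. \<forall>\<^sub>F (x', y) in uniformity. x' = x \<longrightarrow> y \<in> U)"

instance
proof
  fix x y :: "'a ell1" and r :: real
  show "norm x = 0 \<longleftrightarrow> x = 0"
    by transfer (auto simp: fun_eq_iff dest!: nonneg_infsum_le_0D[OF eq_refl])
  show "norm (x + y) \<le> norm x + norm y"
  proof transfer
    fix x y :: "'a \<Rightarrow> real"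
    assume "countable {\<alpha>. x \<alpha> \<noteq> 0} \<and> (\<lambda>\<alpha>. \<bar>x \<alpha>\<bar>) summable_on UNIV"
      and "countable {\<alpha>. y \<alpha> \<noteq> 0} \<and> (\<lambda>\<alpha>. \<bar>y \<alpha>\<bar>) summable_on UNIV"
    then have *: "(\<lambda>\<alpha>. \<bar>x \<alpha>\<bar>) summable_on UNIV" "(\<lambda>\<alpha>. \<bar>y \<alpha>\<bar>) summable_on UNIV"
      by auto
    have "(\<Sum>\<^sub>\<infinity>\<alpha>. \<bar>x \<alpha> + y \<alpha>\<bar>) \<le> (\<Sum>\<^sub>\<infinity>\<alpha>. \<bar>x \<alpha>\<bar> + \<bar>y \<alpha>\<bar>)"
      using abs_summable_lincomb[OF *, of 1 1] *
      by (intro infsum_mono summable_on_add) auto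
    also have "\<dots> = (\<Sum>\<^sub>\<infinity>\<alpha>. \<bar>x \<alpha>\<bar>) + (\<Sum>\<^sub>\<infinity>\<alpha>. \<bar>y \<alpha>\<bar>)"
      by (intro infsum_add *)
    finally show "(\<Sum>\<^sub>\<infinity>\<alpha>. \<bar>x \<alpha> + y \<alpha>\<bar>) \<le> (\<Sum>\<^sub>\<infinity>\<alpha>. \<bar>x \<alpha>\<bar>) + (\<Sum>\<^sub>\<infinity>\<alpha>. \<bar>y \<alpha>\<bar>)" .
  qed
  show "norm (r *\<^sub>R x) = \<bar>r\<bar> * norm x"
    by transfer (simp add: abs_mult infsum_cmult_right')
qed (simp_all add: dist_ell1_def sgn_ell1_def uniformity_ell1_def open_ell1_def)

end

lemma coord_diff: "coord (x - y) \<alpha> = coord x \<alpha> - coord y \<alpha>"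
  by (simp add: minus_ell1.rep_eq)

lemma sum_abs_coord_le_norm: "finite F \<Longrightarrow> (\<Sum>\<alpha>\<in>F. \<bar>coord x \<alpha>\<bar>) \<le> norm x"
  unfolding norm_ell1.rep_eq by (rule finite_sum_le_infsum[OF summable_coord]) auto

lemma abs_coord_le_norm: "\<bar>coord x \<alpha>\<bar> \<le> norm x"
  using sum_abs_coord_le_norm[of "{\<alpha>}" x] by simp

instance ell1 :: (type) banach
proof
  fix X :: "nat \<Rightarrow> 'a ell1"
  assume X: "Cauchy X"
  have "Cauchy (\<lambda>n. coord (X n) \<alpha>)" for \<alpha>
  proof (rule metric_CauchyI)
    fix e :: real assume "e > 0"
    then obtain N where N: "\<And>m n. m \<ge> N \<Longrightarrow> n \<ge> N \<Longrightarrow> dist (X m) (X n) < e"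
      using metric_CauchyD[OF X] by blast
    have "dist (coord (X m) \<alpha>) (coord (X n) \<alpha>) \<le> dist (X m) (X n)" for m n
      using abs_coord_le_norm[of "X m - X n" \<alpha>] by (simp add: coord_diff dist_norm)
    then show "\<exists>N. \<forall>m\<ge>N. \<forall>n\<ge>N. dist (coord (X m) \<alpha>) (coord (X n) \<alpha>) < e"
      using N by (meson le_less_trans)
  qed
  then have lim: "(\<lambda>n. coord (X n) \<alpha>) \<longlonglongrightarrow> lim (\<lambda>n. coord (X n) \<alpha>)" for \<alpha>
    by (simp add: Cauchy_convergent_iff convergent_LIMSEQ_iff)
  define y where "y \<alpha> = lim (\<lambda>n. coord (X n) \<alpha>)" for \<alpha>
  have fin: "\<exists>N. \<forall>n\<ge>N. \<forall>F. finite F \<longrightarrow> (\<Sum>\<alpha>\<in>F. \<bar>coord (X n) \<alpha> - y \<alpha>\<bar>) \<le> e" if "e > 0" for e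
  proof -
    obtain N where N: "\<And>m n. m \<ge> N \<Longrightarrow> n \<ge> N \<Longrightarrow> norm (X m - X n) < e"
      using metric_CauchyD[OF X \<open>e > 0\<close>] by (auto simp: dist_norm)
    have "(\<Sum>\<alpha>\<in>F. \<bar>coord (X n) \<alpha> - y \<alpha>\<bar>) \<le> e" if "n \<ge> N" "finite F" for n F
    proof (rule LIMSEQ_le_const2)
      show "(\<lambda>m. \<Sum>\<alpha>\<in>F. \<bar>coord (X n) \<alpha> - coord (X m) \<alpha>\<bar>)
          \<longlonglongrightarrow> (\<Sum>\<alpha>\<in>F. \<bar>coord (X n) \<alpha> - y \<alpha>\<bar>)"
        unfolding y_def by (intro tendsto_intros lim)
      show "\<exists>M. \<forall>m\<ge>M. (\<Sum>\<alpha>\<in>F. \<bar>coord (X n) \<alpha> - coord (X m) \<alpha>\<bar>) \<le> e"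
      proof (intro exI[of _ N] allI impI)
        fix m assume "m \<ge> N"
        then have "norm (X n - X m) < e"
          using N \<open>n \<ge> N\<close> by blast
        then show "(\<Sum>\<alpha>\<in>F. \<bar>coord (X n) \<alpha> - coord (X m) \<alpha>\<bar>) \<le> e"
          using sum_abs_coord_le_norm[OF \<open>finite F\<close>, of "X n - X m"] by (simp add: coord_diff)
      qed
    qed
    then show ?thesis by blast
  qed
  have summ: "(\<lambda>\<alpha>. \<bar>z \<alpha>\<bar>) summable_on UNIV"
    if "\<And>F. finite F \<Longrightarrow> (\<Sum>\<alpha>\<in>F. \<bar>z \<alpha>\<bar>) \<le> e" for z :: "'a \<Rightarrow> real" and e
    using that by (intro nonneg_bdd_above_summable_on bdd_aboveI2) auto
  obtain N where "\<And>F. finite F \<Longrightarrow> (\<Sum>\<alpha>\<in>F. \<bar>coord (X N) \<alpha> - y \<alpha>\<bar>) \<le> 1"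
    using fin[of 1] by auto
  from abs_summable_lincomb[OF summable_coord[of "X N"] summ[OF this], of 1 "-1"]
  have "(\<lambda>\<alpha>. \<bar>y \<alpha>\<bar>) summable_on UNIV" by simp
  then obtain Y where Y: "coord Y = y"
    using Abs_ell1_inverse[of y] abs_summable_imp_countable_support[of y] by auto
  have "X \<longlonglongrightarrow> Y"
  proof (rule metric_LIMSEQ_I)
    fix e :: real assume "e > 0"
    then obtain N where N: "\<And>n F. n \<ge> N \<Longrightarrow> finite F \<Longrightarrow>
        (\<Sum>\<alpha>\<in>F. \<bar>coord (X n) \<alpha> - y \<alpha>\<bar>) \<le> e / 2"
      using fin[of "e / 2"] by auto
    have "norm (X n - Y) \<le> e / 2" if "n \<ge> N" for n
      unfolding norm_ell1.rep_eq
      by (rule infsum_le_finite_sums[OF summable_coord]) (use N[OF that] in \<open>simp add: coord_diff Y\<close>)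
    then show "\<exists>N. \<forall>n\<ge>N. dist (X n) Y < e"
      using \<open>e > 0\<close> by (intro exI[of _ N]) (force simp: dist_norm)
  qed
  then show "convergent X" by (rule convergentI)
qed


section \<open>Riemann integrability and the Lebesgue property\<close>

class complete_invariant_metric_vector = real_vector + complete_space +
  assumes dist_add_right_invariant: "dist (x + z) (y + z) = dist x y"

instance ell1 :: (type) complete_invariant_metric_vector
  by standard (simp add: dist_norm)

text \<open>
  A tagged partition is given by its length \<open>N\<close>, its division points \<open>t 0, \<dots>, t N\<close> and its
  tags \<open>s 1, \<dots>, s N\<close>; other values of \<open>t\<close> and \<open>s\<close> are irrelevant.
\<close>

definition tagged_partition ::
    "real \<Rightarrow> real \<Rightarrow> nat \<Rightarrow> (nat \<Rightarrow> real) \<Rightarrow> (nat \<Rightarrow> real) \<Rightarrow> bool"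
  where "tagged_partition a b N t s \<longleftrightarrow>
    N \<ge> 1 \<and> t 0 = a \<and> t N = b \<and>
    (\<forall>i\<in>{1..N}. t (i - 1) < t i \<and> s i \<in> {t (i - 1)..t i})"

definition mesh :: "nat \<Rightarrow> (nat \<Rightarrow> real) \<Rightarrow> real"
  where "mesh N t = Max ((\<lambda>i. t i - t (i - 1)) ` {1..N})"

definition Riemann_sum ::
    "(real \<Rightarrow> 'x::real_vector) \<Rightarrow> nat \<Rightarrow> (nat \<Rightarrow> real) \<Rightarrow> (nat \<Rightarrow> real) \<Rightarrow> 'x"
  where "Riemann_sum f N t s = (\<Sum>i = 1..N. (t i - t (i - 1)) *\<^sub>R f (s i))"

definition Riemann_integrable ::
    "(real \<Rightarrow> 'x::complete_invariant_metric_vector) \<Rightarrow> real \<Rightarrow> real \<Rightarrow> bool"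
  where "Riemann_integrable f a b \<longleftrightarrow>
    (\<exists>xbar. \<forall>\<epsilon>>0. \<exists>\<delta>>0. \<forall>N t s.
       tagged_partition a b N t s \<and> mesh N t < \<delta> \<longrightarrow> dist (Riemann_sum f N t s) xbar < \<epsilon>)"

text \<open>
  A function on $[a,b]$ is represented by a total function on the reals; its values outside
  $[a,b]$ play no role, continuity being relative to $[a,b]$.
\<close>

definition Lebesgue_property :: "'x::complete_invariant_metric_vector itself \<Rightarrow> bool"
  where "Lebesgue_property _ \<longleftrightarrow>
    (\<forall>a b. \<forall>f :: real \<Rightarrow> 'x. a < b \<and> Riemann_integrable f a b \<longrightarrow>
       (AE t in lebesgue_on {a..b}. continuous (at t within {a..b}) f))"

end

theory Submission
  imports Defs
begin

text \<open>
  If a Riemann integrable \<open>f\<close> is discontinuous on a set of positive outer measure, then some set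
  \<open>D\<close> of points of oscillation at least \<open>\<epsilon>\<close> has positive outer measure, so in every uniform
  partition the cells meeting \<open>D\<close> have total length bounded below. Going through these cells one
  after the other, one picks two tags \<open>s\<close>, \<open>s'\<close> such that adding \<open>w (f s - f s')\<close> to the partial
  sum \<open>y\<close> increases its norm by at least \<open>w \<epsilon> / 2\<close>; the difference of the two Riemann sums then
  stays away from zero, a contradiction. For real functions such tags exist by choosing the sign.
  This makes every coordinate of an $l^1(\Gamma)$-valued \<open>f\<close> continuous almost everywhere. For \<open>f\<close>
  itself one takes a finite set \<open>F\<close> of indices carrying most of \<open>y\<close> and a point of \<open>D\<close> at which
  the coordinates in \<open>F\<close> are continuous: nearby increments of \<open>f\<close> have large norm but
  almost no mass on \<open>F\<close>, so their norm adds to that of \<open>y\<close>. Only finitely many coordinates are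
  used at each step, which is why \<open>\<Gamma>\<close> may be uncountable.
\<close>

section \<open>Uniform partitions and changes of tags\<close>

definition uniform_point :: "real \<Rightarrow> real \<Rightarrow> nat \<Rightarrow> nat \<Rightarrow> real"
  where "uniform_point a b n i = a + real i * ((b - a) / real n)"

definition uniform_cell :: "real \<Rightarrow> real \<Rightarrow> nat \<Rightarrow> nat \<Rightarrow> real set"
  where "uniform_cell a b n i = {uniform_point a b n (i - 1)..uniform_point a b n i}"

text \<open>A Cauchy-type condition without the value of the integral. It makes sense in every
  normed space and passes from \<open>f\<close> to its coordinates, since \<open>coord\<close> is
  linear and bounded by the norm.\<close>

definition null_tag_changes :: "(real \<Rightarrow> 'x::real_normed_vector) \<Rightarrow> real \<Rightarrow> real \<Rightarrow> bool"
  where "null_tag_changes f a b \<longleftrightarrow>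
    (\<forall>\<eta>>0. \<exists>n\<ge>1. \<forall>s s'. (\<forall>i\<in>{1..n}. s i \<in> uniform_cell a b n i \<and> s' i \<in> uniform_cell a b n i) \<longrightarrow>
       norm (\<Sum>i = 1..n. ((b - a) / real n) *\<^sub>R (f (s i) - f (s' i))) < \<eta>)"

text \<open>Oscillation is measured against the value at \<open>t\<close> itself, so that
  \<open>t\<close> can serve as one of the two tags. The set may fail to be measurable; its size is
  therefore expressed through \<open>negligible\<close>.\<close>

definition osc_points :: "(real \<Rightarrow> 'x::real_normed_vector) \<Rightarrow> real \<Rightarrow> real \<Rightarrow> real \<Rightarrow> real set"
  where "osc_points f a b \<epsilon> =
    {t\<in>{a..b}. \<forall>d>0. \<exists>s\<in>{a..b}. \<bar>s - t\<bar> < d \<and> norm (f s - f t) \<ge> \<epsilon>}"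

lemma uniform_point_step:
  assumes "1 \<le> i"
  shows "uniform_point a b n i - uniform_point a b n (i - 1) = (b - a) / real n"
  using assms by (cases i) (simp_all add: uniform_point_def algebra_simps add_divide_distrib diff_divide_distrib)

lemma uniform_point_mono:
  assumes "a \<le> b" "i \<le> j"
  shows "uniform_point a b n i \<le> uniform_point a b n j"
  unfolding uniform_point_def using assms by (intro add_left_mono mult_right_mono) auto

lemma uniform_point_0 [simp]: "uniform_point a b n 0 = a"
  by (simp add: uniform_point_def)

lemma uniform_point_end [simp]: "n \<ge> 1 \<Longrightarrow> uniform_point a b n n = b"
  by (simp add: uniform_point_def)

lemma tagged_partition_uniform:
  assumes "a < b" "n \<ge> 1" "\<And>i. i \<in> {1..n} \<Longrightarrow> s i \<in> uniform_cell a b n i"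
  shows "tagged_partition a b n (uniform_point a b n) s"
  unfolding tagged_partition_def
proof (intro conjI ballI)
  fix i assume i: "i \<in> {1..n}"
  have "(b - a) / real n > 0" using assms by simp
  then show "uniform_point a b n (i - 1) < uniform_point a b n i"
    using uniform_point_step[of i a b n] i by simp
  show "s i \<in> {uniform_point a b n (i - 1)..uniform_point a b n i}"
    using assms(3)[OF i] by (simp add: uniform_cell_def)
qed (use assms in auto)

lemma mesh_uniform:
  assumes "n \<ge> 1"
  shows "mesh n (uniform_point a b n) = (b - a) / real n"
proof -
  have "(\<lambda>i. uniform_point a b n i - uniform_point a b n (i - 1)) ` {1..n} = (\<lambda>i. (b - a) / real n) ` {1..n}"
    by (intro image_cong refl uniform_point_step) auto
  also have "\<dots> = {(b - a) / real n}" using assms by auto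
  finally show ?thesis by (simp add: mesh_def)
qed

text \<open>Two Riemann sums over one fine uniform partition both lie within \<eta> / 2 of the
  integral, and their difference is the sum of the tag changes.\<close>

lemma Riemann_integrable_null_tag_changes:
  fixes f :: "real \<Rightarrow> 'x::{complete_invariant_metric_vector, real_normed_vector}"
  assumes "a < b" "Riemann_integrable f a b"
  shows "null_tag_changes f a b"
  unfolding null_tag_changes_def
proof (intro allI impI)
  fix \<eta> :: real assume "\<eta> > 0"
  obtain xbar where "\<forall>\<epsilon>>0. \<exists>\<delta>>0. \<forall>N t s.
       tagged_partition a b N t s \<and> mesh N t < \<delta> \<longrightarrow> dist (Riemann_sum f N t s) xbar < \<epsilon>"
    using assms(2) unfolding Riemann_integrable_def by blast
  then obtain \<delta> where "\<delta> > 0" and \<delta>: "\<And>N t s. tagged_partition a b N t s \<Longrightarrow> mesh N t < \<delta> \<Longrightarrow>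
      dist (Riemann_sum f N t s) xbar < \<eta> / 2"
    using \<open>\<eta> > 0\<close> half_gt_zero by metis
  obtain m where m: "(b - a) / \<delta> < real m" using reals_Archimedean2 by blast
  define n where "n = Suc m"
  have n: "n \<ge> 1" "(b - a) / real n < \<delta>"
    using m \<open>\<delta> > 0\<close> by (auto simp: n_def field_simps)
  have "norm (\<Sum>i = 1..n. ((b - a) / real n) *\<^sub>R (f (s i) - f (s' i))) < \<eta>"
    if "\<forall>i\<in>{1..n}. s i \<in> uniform_cell a b n i \<and> s' i \<in> uniform_cell a b n i" for s s'
  proof -
    let ?S = "\<lambda>s. Riemann_sum f n (uniform_point a b n) s"
    have "dist (?S r) xbar < \<eta> / 2" if "\<And>i. i \<in> {1..n} \<Longrightarrow> r i \<in> uniform_cell a b n i" for r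
      using \<delta>[OF tagged_partition_uniform[OF assms(1) n(1) that]] n mesh_uniform by simp
    then have "dist (?S s) xbar < \<eta> / 2" "dist (?S s') xbar < \<eta> / 2"
      using that by blast+
    then have "norm (?S s - ?S s') < \<eta>"
      using dist_triangle_half_l dist_norm by metis
    also have "?S s - ?S s' = (\<Sum>i = 1..n. ((b - a) / real n) *\<^sub>R (f (s i) - f (s' i)))"
      unfolding Riemann_sum_def sum_subtractf[symmetric]
      by (rule sum.cong) (simp_all add: uniform_point_step[simplified] scaleR_diff_right)
    finally show ?thesis .
  qed
  then show "\<exists>n\<ge>1. \<forall>s s'. (\<forall>i\<in>{1..n}. s i \<in> uniform_cell a b n i \<and> s' i \<in> uniform_cell a b n i) \<longrightarrow>
       norm (\<Sum>i = 1..n. ((b - a) / real n) *\<^sub>R (f (s i) - f (s' i))) < \<eta>"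
    using n(1) by blast
qed

section \<open>Accumulating increments over cells heavy in a non-null set\<close>

lemma uniform_cells_cover:
  assumes "n \<ge> 1"
  shows "{a..b} \<subseteq> (\<Union>i\<in>{1..n}. uniform_cell a b n i)"
proof -
  have "{a..uniform_point a b n k} \<subseteq> (\<Union>i\<in>{1..k}. uniform_cell a b n i)" if "k \<ge> 1" for k
    using that
  proof (induction k rule: dec_induct)
    case base
    then show ?case by (simp add: uniform_cell_def)
  next
    case (step k)
    have "{a..uniform_point a b n (Suc k)} \<subseteq> {a..uniform_point a b n k} \<union> uniform_cell a b n (Suc k)"
      by (auto simp: uniform_cell_def)
    also have "\<dots> \<subseteq> (\<Union>i\<in>{1..Suc k}. uniform_cell a b n i)"
      using step by (auto simp: atLeastAtMostSuc_conv)
    finally show ?case .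
  qed
  from this[OF assms] assms show ?thesis by simp
qed

text \<open>The other cells contain only a null part of \<open>D\<close>, so the heavy cells and a
  null set cover \<open>D\<close>. Heavy means more than meeting \<open>D\<close>: a point of
  \<open>D\<close> can then be chosen off any given null set.\<close>

lemma heavy_cells_length:
  assumes "a \<le> b" "D \<subseteq> {a..b}" "\<not> negligible D"
  obtains m where "m > 0"
    "\<forall>n\<ge>1. m \<le> (b - a) / real n * card {i\<in>{1..n}. \<not> negligible (D \<inter> uniform_cell a b n i)}"
proof -
  \<comment> \<open>\<open>m\<close> is a positive lower bound for the outer measure of
    \<open>D\<close>.\<close>
  obtain m where "m > 0" and m: "\<And>T. D \<subseteq> T \<Longrightarrow> T \<in> lmeasurable \<Longrightarrow> m \<le> measure lebesgue T"
    using assms(3) unfolding negligible_outer by (meson not_le)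
  have "m \<le> (b - a) / real n * card {i\<in>{1..n}. \<not> negligible (D \<inter> uniform_cell a b n i)}"
    if "n \<ge> 1" for n
  proof -
    define J where "J = {i\<in>{1..n}. \<not> negligible (D \<inter> uniform_cell a b n i)}"
    define Z where "Z = (\<Union>i\<in>{1..n} - J. D \<inter> uniform_cell a b n i)"
    define U where "U = (\<Union>i\<in>J. uniform_cell a b n i)"
    have "negligible Z"
      unfolding Z_def J_def by (intro negligible_Union) auto
    have cell: "uniform_cell a b n i \<in> lmeasurable" for i
      by (simp add: uniform_cell_def)
    have U: "U \<in> lmeasurable"
      unfolding U_def J_def by (intro fmeasurable.finite_UN cell) auto
    have "D \<subseteq> Z \<union> U"
      using uniform_cells_cover[OF that, of a b] assms(2) unfolding Z_def U_def by blast
    then have "m \<le> measure lebesgue (Z \<union> U)"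
      using m U \<open>negligible Z\<close> by (simp add: fmeasurable.Un negligible_imp_measurable)
    also have "\<dots> = measure lebesgue U"
      using \<open>negligible Z\<close> U
      by (metis measure_Un_null_set Un_commute fmeasurableD negligible_iff_null_sets)
    also have "\<dots> \<le> (\<Sum>i\<in>J. measure lebesgue (uniform_cell a b n i))"
      unfolding U_def by (intro measure_UNION_le) (use cell in \<open>auto simp: J_def\<close>)
    also have "\<dots> = (\<Sum>i\<in>J. (b - a) / real n)"
    proof (rule sum.cong)
      fix i assume "i \<in> J"
      then have "1 \<le> i" by (simp add: J_def)
      then show "measure lebesgue (uniform_cell a b n i) = (b - a) / real n"
        using uniform_point_step[of i a b n] uniform_point_mono[OF assms(1), of "i - 1" i n]
        by (simp add: uniform_cell_def)
    qed simp
    finally show ?thesis by (simp add: J_def mult.commute)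
  qed
  with \<open>m > 0\<close> show ?thesis using that by blast
qed

text \<open>Each heavy cell adds at least \<open>w * c\<close> to the norm of the partial sum, hence
  at least \<open>m * c\<close> in all, against \<open>null_tag_changes\<close> with \<eta> =
  \<open>m * c\<close>. In \<open>add\<close> the vector \<open>y\<close> is arbitrary because it
  stands for the partial sum produced by the earlier choices.\<close>

lemma negligible_if_increments_add:
  fixes f :: "real \<Rightarrow> 'x::real_normed_vector"
  assumes "a < b" "null_tag_changes f a b" "D \<subseteq> {a..b}" "c > 0"
    and add: "\<And>y w u v. w > 0 \<Longrightarrow> a \<le> u \<Longrightarrow> v \<le> b \<Longrightarrow> \<not> negligible (D \<inter> {u..v}) \<Longrightarrow>
      \<exists>s\<in>{u..v}. \<exists>s'\<in>{u..v}. norm y + w * c \<le> norm (y + w *\<^sub>R (f s - f s'))"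
  shows "negligible D"
proof (rule ccontr)
  assume nonnegl: "\<not> negligible D"
  obtain m where "m > 0" and m: "\<forall>n\<ge>1.
      m \<le> (b - a) / real n * card {i\<in>{1..n}. \<not> negligible (D \<inter> uniform_cell a b n i)}"
    by (rule heavy_cells_length[OF less_imp_le[OF assms(1)] assms(3) nonnegl]) blast
  have "m * c > 0" using \<open>m > 0\<close> \<open>c > 0\<close> by simp
  then obtain n where "n \<ge> 1" and n: "\<forall>s s'.
      (\<forall>i\<in>{1..n}. s i \<in> uniform_cell a b n i \<and> s' i \<in> uniform_cell a b n i) \<longrightarrow>
       norm (\<Sum>i = 1..n. ((b - a) / real n) *\<^sub>R (f (s i) - f (s' i))) < m * c"
    using assms(2) unfolding null_tag_changes_def by blast
  define w where "w = (b - a) / real n"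
  have "w > 0" using assms(1) \<open>n \<ge> 1\<close> by (simp add: w_def)
  define J where "J k = {i\<in>{1..k}. \<not> negligible (D \<inter> uniform_cell a b n i)}" for k
  have "\<exists>s s'. (\<forall>i\<in>{1..k}. s i \<in> uniform_cell a b n i \<and> s' i \<in> uniform_cell a b n i) \<and>
      w * c * card (J k) \<le> norm (\<Sum>i = 1..k. w *\<^sub>R (f (s i) - f (s' i)))" if "k \<le> n" for k
    using that
  proof (induction k)
    case 0
    then show ?case by (simp add: J_def)
  next
    case (Suc k)
    then obtain s s' where s: "\<forall>i\<in>{1..k}. s i \<in> uniform_cell a b n i \<and> s' i \<in> uniform_cell a b n i"
      and le: "w * c * card (J k) \<le> norm (\<Sum>i = 1..k. w *\<^sub>R (f (s i) - f (s' i)))"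
      using Suc_leD by blast
    define y where "y = (\<Sum>i = 1..k. w *\<^sub>R (f (s i) - f (s' i)))"
    have "\<exists>p q. p \<in> uniform_cell a b n (Suc k) \<and> q \<in> uniform_cell a b n (Suc k) \<and>
        w * c * card (J (Suc k)) \<le> norm (y + w *\<^sub>R (f p - f q))"
    proof (cases "negligible (D \<inter> uniform_cell a b n (Suc k))")
      case True
      then have "J (Suc k) = J k"
        by (auto simp: J_def atLeastAtMostSuc_conv)
      \<comment> \<open>In a light cell both tags are the same point, so the sum does not
        change.\<close>
      moreover have "uniform_point a b n k \<in> uniform_cell a b n (Suc k)"
        using uniform_point_mono[of a b k "Suc k" n] assms(1) by (simp add: uniform_cell_def)
      ultimately show ?thesis
        using le by (intro exI[of _ "uniform_point a b n k"]) (simp add: y_def)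
    next
      case False
      have "a \<le> uniform_point a b n k" "uniform_point a b n (Suc k) \<le> b"
        using uniform_point_mono[of a b 0 k n] uniform_point_mono[of a b "Suc k" n n] assms(1) Suc.prems \<open>n \<ge> 1\<close>
        by auto
      then obtain p q where pq: "p \<in> uniform_cell a b n (Suc k)" "q \<in> uniform_cell a b n (Suc k)"
        "norm y + w * c \<le> norm (y + w *\<^sub>R (f p - f q))"
        using add[OF \<open>w > 0\<close>, of "uniform_point a b n k" "uniform_point a b n (Suc k)" y] False
        by (auto simp: uniform_cell_def)
      have "J (Suc k) = insert (Suc k) (J k)" "Suc k \<notin> J k" "finite (J k)"
        using False by (auto simp: J_def)
      then have "w * c * card (J (Suc k)) = w * c * card (J k) + w * c"
        by (simp add: algebra_simps)
      then show ?thesis using pq le unfolding y_def by (intro exI[of _ p] exI[of _ q]) linarith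
    qed
    then obtain p q where pq: "p \<in> uniform_cell a b n (Suc k)" "q \<in> uniform_cell a b n (Suc k)"
        "w * c * card (J (Suc k)) \<le> norm (y + w *\<^sub>R (f p - f q))" by blast
    have "(\<Sum>i = 1..Suc k. w *\<^sub>R (f ((s(Suc k := p)) i) - f ((s'(Suc k := q)) i))) = y + w *\<^sub>R (f p - f q)"
      by (simp add: y_def)
    then show ?case
      using s pq by (intro exI[of _ "s(Suc k := p)"] exI[of _ "s'(Suc k := q)"]) auto
  qed
  from this[of n] obtain s s' where
    "\<forall>i\<in>{1..n}. s i \<in> uniform_cell a b n i \<and> s' i \<in> uniform_cell a b n i"
    "w * c * card (J n) \<le> norm (\<Sum>i = 1..n. w *\<^sub>R (f (s i) - f (s' i)))"
    by blast
  then have "w * c * card (J n) < m * c"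
    using n unfolding w_def by (meson le_less_trans)
  moreover have "m * c \<le> w * card (J n) * c"
    using m \<open>n \<ge> 1\<close> \<open>c > 0\<close> unfolding w_def J_def by (intro mult_right_mono) auto
  ultimately show False by (simp add: mult_ac)
qed

section \<open>Oscillation and the set of discontinuities\<close>

lemma osc_points_subset: "osc_points f a b \<epsilon> \<subseteq> {a..b}"
  by (auto simp: osc_points_def)

lemma discontinuities_eq_osc_points:
  "{t\<in>{a..b}. \<not> continuous (at t within {a..b}) f} = (\<Union>k. osc_points f a b (1 / Suc k))"
proof (intro equalityI subsetI)
  fix t assume "t \<in> {t\<in>{a..b}. \<not> continuous (at t within {a..b}) f}"
  then have t: "t \<in> {a..b}"
    and "\<not> (\<forall>e>0. \<exists>d>0. \<forall>s\<in>{a..b}. dist s t < d \<longrightarrow> dist (f s) (f t) < e)"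
    unfolding continuous_within_eps_delta by blast+
  then obtain e where "e > 0" and e: "\<And>d. d > 0 \<Longrightarrow> \<exists>s\<in>{a..b}. dist s t < d \<and> e \<le> dist (f s) (f t)"
    by (meson not_less)
  obtain k where "1 / Suc k < e" using \<open>e > 0\<close> nat_approx_posE by blast
  then have "t \<in> osc_points f a b (1 / Suc k)"
    using t e unfolding osc_points_def dist_norm real_norm_def
    by (blast intro: order_trans less_imp_le)
  then show "t \<in> (\<Union>k. osc_points f a b (1 / Suc k))" by blast
next
  fix t assume "t \<in> (\<Union>k. osc_points f a b (1 / Suc k))"
  then obtain k where k: "t \<in> osc_points f a b (1 / Suc k)" by blast
  have "\<not> continuous (at t within {a..b}) f"
  proof
    assume "continuous (at t within {a..b}) f"
    moreover have "1 / real (Suc k) > 0" by simp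
    ultimately obtain d where "d > 0" "\<forall>s\<in>{a..b}. dist s t < d \<longrightarrow> dist (f s) (f t) < 1 / Suc k"
      unfolding continuous_within_eps_delta by blast
    then show False
      using k unfolding osc_points_def dist_norm real_norm_def by (blast dest: leD)
  qed
  then show "t \<in> {t\<in>{a..b}. \<not> continuous (at t within {a..b}) f}"
    using k by (auto simp: osc_points_def)
qed

lemma negligible_discontinuities:
  assumes "\<And>\<epsilon>. \<epsilon> > 0 \<Longrightarrow> negligible (osc_points f a b \<epsilon>)"
  shows "negligible {t\<in>{a..b}. \<not> continuous (at t within {a..b}) f}"
  unfolding discontinuities_eq_osc_points by (rule negligible_Union_nat) (simp add: assms)

lemma osc_points_nearby:
  assumes "t \<in> osc_points f a b \<epsilon>" "u < t" "t < v" "a \<le> u" "v \<le> b"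
    and "eventually P (at t within {a..b})" "P t"
  obtains s where "s \<in> {u..v}" "P s" "\<epsilon> \<le> norm (f s - f t)"
proof -
  obtain d where "d > 0" and d: "\<And>s. s \<in> {a..b} \<Longrightarrow> \<bar>s - t\<bar> < d \<Longrightarrow> s \<noteq> t \<Longrightarrow> P s"
    using assms(6) unfolding eventually_at dist_real_def by blast
  \<comment> \<open>The radius keeps \<open>s\<close> both where \<open>P\<close> holds and inside
    the cell.\<close>
  have "min d (min (t - u) (v - t)) > 0"
    using assms(2,3) \<open>d > 0\<close> by simp
  then obtain s where "s \<in> {a..b}" "\<bar>s - t\<bar> < min d (min (t - u) (v - t))" "\<epsilon> \<le> norm (f s - f t)"
    using assms(1) unfolding osc_points_def by blast
  moreover from this have "s \<in> {u..v}" by auto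
  \<comment> \<open>The filter says nothing at \<open>t\<close> itself; \<open>P t\<close> covers
    the case \<open>s = t\<close>, possible when \<epsilon> \<le> 0.\<close>
  ultimately show ?thesis
    using that[of s] d[of s] assms(7) by (cases "s = t") auto
qed

lemma nonnegligible_interior_point:
  fixes u v :: real
  assumes "\<not> negligible (D \<inter> {u..v})" "negligible N"
  obtains t where "t \<in> D" "u < t" "t < v" "t \<notin> N"
proof -
  \<comment> \<open>The end points are added to the null set so that \<open>t\<close> is interior
    and a full neighbourhood of it lies in the cell.\<close>
  have "\<not> D \<inter> {u..v} \<subseteq> N \<union> {u, v}"
    using assms negligible_subset negligible_Un
    by (metis finite.emptyI finite.insertI negligible_finite)
  then show ?thesis using that by force
qed

section \<open>Real-valued functions\<close>

lemma negligible_discontinuities_real: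
  fixes g :: "real \<Rightarrow> real"
  assumes "a < b" "null_tag_changes g a b"
  shows "negligible {t\<in>{a..b}. \<not> continuous (at t within {a..b}) g}"
proof (rule negligible_discontinuities)
  fix \<epsilon> :: real assume "\<epsilon> > 0"
  show "negligible (osc_points g a b \<epsilon>)"
  proof (rule negligible_if_increments_add[OF assms osc_points_subset \<open>\<epsilon> > 0\<close>])
    fix y w u v :: real
    assume *: "w > 0" "a \<le> u" "v \<le> b" "\<not> negligible (osc_points g a b \<epsilon> \<inter> {u..v})"
    obtain t where t: "t \<in> osc_points g a b \<epsilon>" "u < t" "t < v"
      using nonnegligible_interior_point[OF *(4) negligible_empty] by blast
    obtain s where s: "s \<in> {u..v}" "\<epsilon> \<le> \<bar>g s - g t\<bar>"
      using osc_points_nearby[OF t *(2,3), of "\<lambda>_. True"] by auto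
    have "w * \<epsilon> \<le> w * \<bar>g s - g t\<bar>" using s(2) *(1) by simp
    also have "\<dots> = \<bar>w * (g s - g t)\<bar>" using *(1) by (simp add: abs_mult)
    \<comment> \<open>Exchanging the two tags reverses the sign of the increment; with the sign of
      \<open>y\<close> its absolute value adds fully.\<close>
    finally have "\<bar>y\<bar> + w * \<epsilon> \<le> \<bar>y + w * (g s - g t)\<bar> \<or> \<bar>y\<bar> + w * \<epsilon> \<le> \<bar>y + w * (g t - g s)\<bar>"
      unfolding right_diff_distrib by linarith
    then show "\<exists>s\<in>{u..v}. \<exists>s'\<in>{u..v}. norm y + w * \<epsilon> \<le> norm (y + w *\<^sub>R (g s - g s'))"
      using s(1) t(2,3) unfolding real_norm_def real_scaleR_def by (meson atLeastAtMost_iff less_imp_le)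
  qed
qed

section \<open>Coordinates and norm estimates in the space of summable families\<close>

lemma coord_add: "coord (x + y) \<alpha> = coord x \<alpha> + coord y \<alpha>"
  by (simp add: plus_ell1.rep_eq)

lemma coord_scaleR: "coord (r *\<^sub>R x) \<alpha> = r * coord x \<alpha>"
  by (simp add: scaleR_ell1.rep_eq)

lemma coord_sum: "coord (\<Sum>i\<in>A. g i) \<alpha> = (\<Sum>i\<in>A. coord (g i) \<alpha>)"
  by (induction A rule: infinite_finite_induct) (simp_all add: coord_add zero_ell1.rep_eq)

lemma null_tag_changes_coord:
  assumes "null_tag_changes f a b"
  shows "null_tag_changes (\<lambda>t. coord (f t) \<alpha>) a b"
proof -
  have le: "norm (\<Sum>i = 1..n. w *\<^sub>R (coord (f (s i)) \<alpha> - coord (f (s' i)) \<alpha>))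
      \<le> norm (\<Sum>i = 1..n. w *\<^sub>R (f (s i) - f (s' i)))" for n :: nat and w and s s'
    using abs_coord_le_norm[of "\<Sum>i = 1..n. w *\<^sub>R (f (s i) - f (s' i))" \<alpha>]
    by (simp add: coord_sum coord_scaleR coord_diff)
  show ?thesis
    unfolding null_tag_changes_def
  proof (intro allI impI)
    fix \<eta> :: real assume "\<eta> > 0"
    then obtain n where "n \<ge> 1" and n: "\<forall>s s'.
        (\<forall>i\<in>{1..n}. s i \<in> uniform_cell a b n i \<and> s' i \<in> uniform_cell a b n i) \<longrightarrow>
        norm (\<Sum>i = 1..n. ((b - a) / real n) *\<^sub>R (f (s i) - f (s' i))) < \<eta>"
      using assms unfolding null_tag_changes_def by blast
    then show "\<exists>n\<ge>1. \<forall>s s'. (\<forall>i\<in>{1..n}. s i \<in> uniform_cell a b n i \<and> s' i \<in> uniform_cell a b n i) \<longrightarrow>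
        norm (\<Sum>i = 1..n. ((b - a) / real n) *\<^sub>R (coord (f (s i)) \<alpha> - coord (f (s' i)) \<alpha>)) < \<eta>"
      by (intro exI[of _ n] conjI allI impI le_less_trans[OF le]) blast+
  qed
qed

lemma norm_ell1_finite_approx:
  assumes "\<kappa> > 0"
  obtains F where "finite F" "norm y - \<kappa> < (\<Sum>\<alpha>\<in>F. \<bar>coord y \<alpha>\<bar>)"
proof -
  have "\<exists>F. finite F \<and> norm y - \<kappa> < (\<Sum>\<alpha>\<in>F. \<bar>coord y \<alpha>\<bar>)"
  proof (rule ccontr)
    assume "\<not> ?thesis"
    then have "norm y \<le> norm y - \<kappa>"
      unfolding norm_ell1.rep_eq by (intro infsum_le_finite_sums[OF summable_coord]) force
    with assms show False by simp
  qed
  with that show ?thesis by blast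
qed

text \<open>The reverse triangle inequality is used with \<open>y\<close> dominant on
  \<open>F\<close> and \<open>z\<close> dominant off \<open>F\<close>; the mass off \<open>F\<close>
  is then written as the norm minus the mass on \<open>F\<close>.\<close>

lemma norm_ell1_add_ge:
  assumes F: "finite F"
  shows "2 * (\<Sum>\<alpha>\<in>F. \<bar>coord y \<alpha>\<bar>) - norm y + norm z - 2 * (\<Sum>\<alpha>\<in>F. \<bar>coord z \<alpha>\<bar>) \<le> norm (y + z)"
proof -
  let ?n = "\<lambda>x A. \<Sum>\<^sub>\<infinity>\<alpha>\<in>A. \<bar>coord x \<alpha>\<bar>"
  have summ: "(\<lambda>\<alpha>. \<bar>coord x \<alpha>\<bar>) summable_on A" for x :: "'a ell1" and A
    by (rule summable_on_subset_banach[OF summable_coord]) simp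
  have split: "norm x = (\<Sum>\<alpha>\<in>F. \<bar>coord x \<alpha>\<bar>) + ?n x (- F)" for x :: "'a ell1"
    using infsum_Un_disjoint[OF summ summ, of F "- F" x] F by (simp add: norm_ell1.rep_eq)
  have "(\<Sum>\<alpha>\<in>F. \<bar>coord y \<alpha>\<bar>) \<le> (\<Sum>\<alpha>\<in>F. \<bar>coord (y + z) \<alpha>\<bar>) + (\<Sum>\<alpha>\<in>F. \<bar>coord z \<alpha>\<bar>)"
    unfolding sum.distrib[symmetric] by (rule sum_mono) (simp add: coord_add)
  moreover have "?n z (- F) \<le> ?n (y + z) (- F) + ?n y (- F)"
    unfolding infsum_add[OF summ summ, symmetric]
    by (intro infsum_mono summ summable_on_add) (simp add: coord_add)
  ultimately show ?thesis
    using split[of y] split[of z] split[of "y + z"] by linarith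
qed

section \<open>Continuity almost everywhere for values in the space of summable families\<close>

lemma negligible_discontinuities_ell1:
  fixes f :: "real \<Rightarrow> 'i ell1"
  assumes "a < b" "null_tag_changes f a b"
  shows "negligible {t\<in>{a..b}. \<not> continuous (at t within {a..b}) f}"
proof (rule negligible_discontinuities)
  fix \<epsilon> :: real assume "\<epsilon> > 0"
  show "negligible (osc_points f a b \<epsilon>)"
  proof (rule negligible_if_increments_add[OF assms osc_points_subset half_gt_zero[OF \<open>\<epsilon> > 0\<close>]])
    fix y :: "'i ell1" and w u v :: real
    assume *: "w > 0" "a \<le> u" "v \<le> b" "\<not> negligible (osc_points f a b \<epsilon> \<inter> {u..v})"
    \<comment> \<open>\<open>norm_ell1_add_ge\<close> loses 2\<kappa> from the mass of
      \<open>y\<close> off \<open>F\<close> and 2\<kappa> from that of the increment on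
      \<open>F\<close>. With \<kappa> = \<open>w * \<epsilon> / 8\<close>, half of the gain
      \<open>w * \<epsilon>\<close> remains.\<close>
    define \<kappa> where "\<kappa> = w * \<epsilon> / 8"
    have "\<kappa> > 0" using *(1) \<open>\<epsilon> > 0\<close> by (simp add: \<kappa>_def)
    then obtain F where F: "finite F" "norm y - \<kappa> < (\<Sum>\<alpha>\<in>F. \<bar>coord y \<alpha>\<bar>)"
      using norm_ell1_finite_approx by blast
    define N where "N = (\<Union>\<alpha>\<in>F. {t\<in>{a..b}. \<not> continuous (at t within {a..b}) (\<lambda>t. coord (f t) \<alpha>)})"
    have "negligible N"
      unfolding N_def using F(1) negligible_discontinuities_real[OF assms(1) null_tag_changes_coord[OF assms(2)]]
      by (intro negligible_Union) blast+
    \<comment> \<open>\<open>F\<close>, and with it \<open>N\<close>, depends on \<open>y\<close>,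
      so \<open>t\<close> is chosen only now; the cell is heavy, hence its part of the oscillation
      set is not absorbed by \<open>N\<close>.\<close>
    then obtain t where t: "t \<in> osc_points f a b \<epsilon>" "u < t" "t < v" "t \<notin> N"
      using nonnegligible_interior_point[OF *(4)] by blast
    let ?h = "\<lambda>s. \<Sum>\<alpha>\<in>F. \<bar>coord (w *\<^sub>R (f s - f t)) \<alpha>\<bar>"
    have "((\<lambda>s. coord (f s) \<alpha>) \<longlongrightarrow> coord (f t) \<alpha>) (at t within {a..b})" if "\<alpha> \<in> F" for \<alpha>
      using t that *(2,3) by (auto simp: N_def continuous_within)
    then have "(?h \<longlongrightarrow> (\<Sum>\<alpha>\<in>F. \<bar>w * (coord (f t) \<alpha> - coord (f t) \<alpha>)\<bar>)) (at t within {a..b})"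
      unfolding coord_scaleR coord_diff by (intro tendsto_intros)
    \<comment> \<open>The limit of \<open>?h\<close> at \<open>t\<close> is 0, being a finite sum of
      zeros.\<close>
    then have "\<forall>\<^sub>F s in at t within {a..b}. ?h s < \<kappa>"
      using \<open>\<kappa> > 0\<close> by (simp add: order_tendstoD)
    moreover have "?h t < \<kappa>" using \<open>\<kappa> > 0\<close> by (simp add: zero_ell1.rep_eq)
    ultimately obtain s where s: "s \<in> {u..v}" "?h s < \<kappa>" "\<epsilon> \<le> norm (f s - f t)"
      using osc_points_nearby[OF t(1-3) *(2,3), of "\<lambda>s. ?h s < \<kappa>"] by blast
    have "w * \<epsilon> \<le> norm (w *\<^sub>R (f s - f t))" using s(3) *(1) by simp
    then have "norm y + w * (\<epsilon> / 2) \<le> norm (y + w *\<^sub>R (f s - f t))"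
      using norm_ell1_add_ge[OF F(1), of y "w *\<^sub>R (f s - f t)"] F(2) s(2) unfolding \<kappa>_def by linarith
    then show "\<exists>s\<in>{u..v}. \<exists>s'\<in>{u..v}. norm y + w * (\<epsilon> / 2) \<le> norm (y + w *\<^sub>R (f s - f s'))"
      using s(1) t(2,3) by (meson atLeastAtMost_iff less_imp_le)
  qed
qed

theorem theorem3p1:
  assumes "uncountable (UNIV :: 'i set)"
  shows "Lebesgue_property TYPE('i ell1)"
  unfolding Lebesgue_property_def
proof (intro allI impI, elim conjE)
  fix a b :: real and f :: "real \<Rightarrow> 'i ell1"
  assume "a < b" "Riemann_integrable f a b"
  then have "negligible {t\<in>{a..b}. \<not> continuous (at t within {a..b}) f}"
    by (intro negligible_discontinuities_ell1 Riemann_integrable_null_tag_changes)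
  then have "{t\<in>{a..b}. \<not> continuous (at t within {a..b}) f} \<in> null_sets (lebesgue_on {a..b})"
    by (auto simp: null_sets_restrict_space negligible_iff_null_sets)
  then show "AE t in lebesgue_on {a..b}. continuous (at t within {a..b}) f"
    by (rule AE_I') (auto simp: space_restrict_space)
qed

end
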